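(* For all $\tau\in\mathbb{H}$, $$\frac{u^4}{v^2}+\frac{w^4}{u^2}+\frac{v^4}{w^2}=2\,\eta(\tau)^2\,j_7^*(\tau)^{1/3},$$ $$\frac{v^2}{u^4}+\frac{u^2}{w^4}+\frac{w^2}{v^4}=\frac{\eta^2(\tau)}{\eta^4(7\tau)}\,j_7^*(\tau)^{2/3},$$ where $j_7^*(\tau)^{1/3}$ is the cube root of $j_7^*$ meromorphic on $\mathbb{H}$ whose $q$-expansion begins $q^{-1/3}(1+O(q))$, and $j_7^*(\tau)^{2/3}=(j_7^*(\tau)^{1/3})^2$.
   Context: Let $\tau\in\mathbb{H}$, $q=e^{2\pi i\tau}$, $q^{\alpha}=e^{2\pi i\alpha\tau}$. Define $u=q^{1/56}\prod_{k\ge0}(1-q^{7k+3})(1-q^{7k+4})(1-q^{7k+7})$, $v=q^{9/56}\prod_{k\ge0}(1-q^{7k+2})(1-q^{7k+5})(1-q^{7k+7})$, $w=q^{25/56}\prod_{k\ge0}(1-q^{7k+1})(1-q^{7k+6})(1-q^{7k+7})$, $\eta(\tau)=q^{1/24}\prod_{n\ge1}(1-q^n)$, and $j_7^*(\tau)=\left(\frac{\eta(\tau)}{\eta(7\tau)}\right)^4+13+49\left(\frac{\eta(7\tau)}{\eta(\tau)}\right)^4$. *)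

theory Defs
  imports "HOL-Analysis.Analysis"
begin

definition uhp :: "complex set" where
  "uhp = {\<tau>. Im \<tau> > 0}"

definition qpow :: "real \<Rightarrow> complex \<Rightarrow> complex" where
  "qpow \<alpha> \<tau> = exp (2 * of_real pi * \<i> * of_real \<alpha> * \<tau>)"

definition qq :: "complex \<Rightarrow> complex" where
  "qq \<tau> = qpow 1 \<tau>"

definition u7 :: "complex \<Rightarrow> complex" where
  "u7 \<tau> = qpow (1/56) \<tau> *
     (\<Prod>k. (1 - qq \<tau> ^ (7*k+3)) * (1 - qq \<tau> ^ (7*k+4)) * (1 - qq \<tau> ^ (7*k+7)))"

definition v7 :: "complex \<Rightarrow> complex" where
  "v7 \<tau> = qpow (9/56) \<tau> *
     (\<Prod>k. (1 - qq \<tau> ^ (7*k+2)) * (1 - qq \<tau> ^ (7*k+5)) * (1 - qq \<tau> ^ (7*k+7)))"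

definition w7 :: "complex \<Rightarrow> complex" where
  "w7 \<tau> = qpow (25/56) \<tau> *
     (\<Prod>k. (1 - qq \<tau> ^ (7*k+1)) * (1 - qq \<tau> ^ (7*k+6)) * (1 - qq \<tau> ^ (7*k+7)))"

definition eta :: "complex \<Rightarrow> complex" where
  "eta \<tau> = qpow (1/24) \<tau> * (\<Prod>n. (1 - qq \<tau> ^ (Suc n)))"

definition j7star :: "complex \<Rightarrow> complex" where
  "j7star \<tau> = (eta \<tau> / eta (7*\<tau>)) ^ 4 + 13 + 49 * (eta (7*\<tau>) / eta \<tau>) ^ 4"

definition at_i_infinity :: "complex filter" where
  "at_i_infinity = filtercomap Im at_top"

end

theory Submission
  imports Defs "HOL-Complex_Analysis.Complex_Analysis" "HOL-Real_Asymp.Real_Asymp"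
begin

text \<open>
  Up to powers of \<open>q\<close> and a common factor, \<open>w, v, u\<close> are the values \<open>a, b, c\<close> of the theta
  function with base \<open>p = q^7\<close> at the seven-torsion points \<open>q, q^2, q^3\<close> of the curve
  \<open>\<complex>\<^sup>* / p^\<int>\<close>. Put \<open>X = c^3 a\<close>, \<open>Y = b^3 c\<close>, \<open>Z = q a^3 b\<close>, \<open>M = a b c\<close>, so that
  \<open>X Y Z = q M^4\<close>. The addition theorem at the three points is Klein's quartic \<open>Y = X + Z\<close>.
  Moreover the monic cubic whose roots are the \<open>\<wp>\<close>-values at the two-torsion points takes, by
  duplication, known values at the \<open>\<wp>\<close>-values of \<open>q, q^2, q^3\<close>, which determines it, while its
  discriminant is \<open>p / 16\<close>. This gives \<open>M^8 = X^3 - 5 X^2 Z - 8 X Z^2 - Z^3\<close>. Since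
  \<open>M^4 / q = (\<eta>(\<tau>) / \<eta>(7\<tau>))^4\<close>, both claims become polynomial identities in \<open>X\<close> and \<open>Z\<close>, the
  cube root being \<open>q^(-1/3) (X^2 + Y^2 + Z^2) / (2 M^4)\<close>.
\<close>

subsection \<open>Infinite products and the theta function\<close>

definition qpoch :: "complex \<Rightarrow> complex \<Rightarrow> complex" where
  "qpoch p x = (\<Prod>n. 1 - x * p ^ n)"

definition theta :: "complex \<Rightarrow> complex \<Rightarrow> complex" where
  "theta p x = qpoch p x * qpoch p (p / x)"

lemma convergent_qpoch:
  assumes "norm p < 1"
  shows "convergent_prod (\<lambda>n. 1 - x * p ^ n :: complex)"
proof (intro abs_convergent_prod_imp_convergent_prod summable_imp_abs_convergent_prod)
  have "summable (\<lambda>n. norm x * norm p ^ n)"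
    using assms by (intro summable_mult summable_geometric) auto
  thus "summable (\<lambda>n. norm (1 - x * p ^ n - 1))"
    by (simp add: norm_mult norm_power)
qed

lemma qpoch_tendsto:
  assumes "norm p < 1"
  shows "(\<lambda>N. \<Prod>n<N. 1 - x * p ^ n) \<longlonglongrightarrow> qpoch p x"
  unfolding qpoch_def
  by (intro has_prod_imp_tendsto' convergent_prod_has_prod convergent_qpoch assms)

lemma qpoch_base_0 [simp]: "qpoch 0 x = 1 - x"
proof -
  have "(\<lambda>N. \<Prod>n<Suc N. 1 - x * 0 ^ n) \<longlonglongrightarrow> qpoch 0 x"
    by (intro LIMSEQ_Suc qpoch_tendsto) auto
  moreover have "(\<Prod>n<Suc N. 1 - x * 0 ^ n) = 1 - x" for N
    by (subst prod.lessThan_Suc_shift) simp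
  ultimately show ?thesis
    by (simp only: LIMSEQ_const_iff)
qed

lemma qpoch_rec:
  assumes "norm p < 1"
  shows "qpoch p x = (1 - x) * qpoch p (p * x)"
proof -
  have "(\<lambda>N. \<Prod>n<Suc N. 1 - x * p ^ n) \<longlonglongrightarrow> qpoch p x"
    by (intro LIMSEQ_Suc qpoch_tendsto assms)
  moreover have "(\<Prod>n<Suc N. 1 - x * p ^ n) = (1 - x) * (\<Prod>n<N. 1 - p * x * p ^ n)" for N
    by (subst prod.lessThan_Suc_shift) (simp add: mult_ac)
  ultimately have "(\<lambda>N. (1 - x) * (\<Prod>n<N. 1 - p * x * p ^ n)) \<longlonglongrightarrow> qpoch p x"
    by (simp only:)
  thus ?thesis
    by (rule LIMSEQ_unique) (intro tendsto_intros qpoch_tendsto assms)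
qed

lemma qpoch_nonzero:
  assumes "norm p < 1" "norm x < 1"
  shows "qpoch p x \<noteq> 0"
  unfolding qpoch_def
proof (intro prodinf_nonzero convergent_qpoch assms)
  fix n
  have "norm (x * p ^ n) < 1"
    using assms mult_left_le[of "norm p ^ n" "norm x"]
    by (simp add: norm_mult norm_power power_le_one le_less_trans)
  thus "1 - x * p ^ n \<noteq> 0" by auto
qed

text \<open>Sorting the exponents by residue modulo \<open>m\<close> regroups the first
  \<open>N * m\<close> factors; both sides are limits of these partial products.\<close>

lemma qpoch_dissect:
  assumes "norm p < 1" "m > 0"
  shows "qpoch p x = (\<Prod>i<m. qpoch (p ^ m) (x * p ^ i))"
proof -
  have "norm (p ^ m) < 1"
    using assms by (simp add: norm_power power_less_one_iff)
  hence "(\<lambda>N. \<Prod>i<m. \<Prod>n<N. 1 - x * p ^ i * (p ^ m) ^ n) \<longlonglongrightarrow> (\<Prod>i<m. qpoch (p ^ m) (x * p ^ i))"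
    by (intro tendsto_prod qpoch_tendsto)
  moreover have "(\<Prod>i<m. \<Prod>n<N. 1 - x * p ^ i * (p ^ m) ^ n) = (\<Prod>n<N * m. 1 - x * p ^ n)" for N
  proof -
    have "(\<Prod>n = k * m..<k * m + m. 1 - x * p ^ n) = (\<Prod>i<m. 1 - x * p ^ i * (p ^ m) ^ k)" for k
      using prod.shift_bounds_nat_ivl[of "\<lambda>n. 1 - x * p ^ n" 0 "k * m" m]
      by (simp add: atLeast0LessThan add.commute power_add power_mult[symmetric] mult_ac)
    thus ?thesis
      by (subst prod.nat_group[symmetric], subst prod.swap) simp
  qed
  moreover have "(\<lambda>N. \<Prod>n<N * m. 1 - x * p ^ n) \<longlonglongrightarrow> qpoch p x"
    using filterlim_compose[OF qpoch_tendsto[OF assms(1)], of "\<lambda>N. N * m"]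
      mult_nat_right_at_top[OF assms(2)] by simp
  ultimately show ?thesis
    by (simp add: LIMSEQ_unique)
qed

lemma qpoch_square:
  assumes "norm r < 1"
  shows "qpoch (r\<^sup>2) (x\<^sup>2) = qpoch r x * qpoch r (-x)"
proof -
  have "norm (r\<^sup>2) < 1"
    using assms by (simp add: norm_power power_less_one_iff)
  hence "(\<lambda>N. \<Prod>n<N. 1 - x\<^sup>2 * (r\<^sup>2) ^ n) \<longlonglongrightarrow> qpoch (r\<^sup>2) (x\<^sup>2)"
    by (rule qpoch_tendsto)
  moreover have "(\<Prod>n<N. 1 - x\<^sup>2 * (r\<^sup>2) ^ n)
      = (\<Prod>n<N. 1 - x * r ^ n) * (\<Prod>n<N. 1 - (-x) * r ^ n)" for N
    unfolding prod.distrib[symmetric]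
    by (intro prod.cong refl)
       (simp add: algebra_simps power2_eq_square power_mult_distrib)
  ultimately show ?thesis
    using LIMSEQ_unique tendsto_mult[OF qpoch_tendsto[OF assms, of x] qpoch_tendsto[OF assms, of "-x"]]
    by simp
qed

text \<open>\<open>qpoch_square\<close> splits into base \<open>r\<close> at \<open>x\<close> and
  \<open>-x\<close>; each part is then split by the parity of the exponent into base
  \<open>r\<^sup>2\<close>.\<close>

lemma qpoch_duplication:
  assumes "norm r < 1"
  shows "qpoch (r\<^sup>2) (x\<^sup>2)
    = qpoch (r\<^sup>2) x * qpoch (r\<^sup>2) (-x) * qpoch (r\<^sup>2) (r * x) * qpoch (r\<^sup>2) (- (r * x))"
proof -
  have "qpoch r y = qpoch (r\<^sup>2) y * qpoch (r\<^sup>2) (r * y)" for y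
    using qpoch_dissect[OF assms, of 2 y] by (simp add: lessThan_Suc eval_nat_numeral mult_ac)
  thus ?thesis
    by (simp add: qpoch_square[OF assms])
qed

text \<open>Base and argument both vary, since \<open>q\<close> enters both in
  \<open>theta7\<close>. On a closed disc the factors differ from 1 by at most a geometric term, so
  the products converge uniformly.\<close>

lemma qpoch_holomorphic [holomorphic_intros]:
  assumes "open S" "f holomorphic_on S" "g holomorphic_on S" "\<And>z. z \<in> S \<Longrightarrow> norm (g z) < 1"
  shows "(\<lambda>z. qpoch (g z) (f z)) holomorphic_on S"
proof (rule holomorphic_uniform_sequence[OF assms(1)])
  show "(\<lambda>z. \<Prod>n<N. 1 - f z * g z ^ n) holomorphic_on S" for N
    by (intro holomorphic_intros assms)
next
  fix a assume "a \<in> S"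
  then obtain d where d: "d > 0" "cball a d \<subseteq> S"
    using assms(1) open_contains_cball by blast
  have contf: "continuous_on (cball a d) f" and contg: "continuous_on (cball a d) g"
    using assms d holomorphic_on_imp_continuous_on holomorphic_on_subset by blast+
  obtain B where B: "\<And>z. z \<in> cball a d \<Longrightarrow> norm (f z) \<le> B"
    using compact_imp_bounded[OF compact_continuous_image[OF contf compact_cball]]
    by (force simp: bounded_iff)
  \<comment> \<open>\<open>w\<close> maximises the modulus of \<open>g\<close> on the disc, so
    \<open>norm (g w)\<close> is one ratio below 1 that serves the whole disc.\<close>
  obtain w where w: "w \<in> cball a d" "\<And>z. z \<in> cball a d \<Longrightarrow> norm (g z) \<le> norm (g w)"
    using continuous_attains_sup[OF compact_cball _ continuous_on_norm[OF contg]] d(1)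
    by (metis cball_eq_empty less_le_not_le not_le)
  have "norm (g w) < 1"
    using assms(4) w(1) d(2) by blast
  have "uniformly_convergent_on (cball a d) (\<lambda>N z. \<Prod>n<N. 1 - f z * g z ^ n)"
  proof (rule uniformly_convergent_on_prod')
    show "uniformly_convergent_on (cball a d) (\<lambda>N z. \<Sum>n<N. norm (1 - f z * g z ^ n - 1))"
    proof (rule Weierstrass_m_test'_ev)
      show "\<forall>\<^sub>F n in sequentially. \<forall>z\<in>cball a d.
              norm (norm (1 - f z * g z ^ n - 1)) \<le> B * norm (g w) ^ n"
        using B w order.trans[OF norm_ge_zero B[OF w(1)]]
        by (intro always_eventually allI ballI) (auto simp: norm_mult norm_power intro!: mult_mono power_mono)
      show "summable (\<lambda>n. B * norm (g w) ^ n)"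
        using \<open>norm (g w) < 1\<close> by (intro summable_mult summable_geometric) auto
    qed
  qed (auto intro!: continuous_intros contf contg)
  then obtain h where h: "uniform_limit (cball a d) (\<lambda>N z. \<Prod>n<N. 1 - f z * g z ^ n) h sequentially"
    by (auto simp: uniformly_convergent_on_def)
  have "h z = qpoch (g z) (f z)" if "z \<in> cball a d" for z
    using LIMSEQ_unique[OF tendsto_uniform_limitI[OF h that] qpoch_tendsto] that d(2) assms(4) by blast
  hence "uniform_limit (cball a d) (\<lambda>N z. \<Prod>n<N. 1 - f z * g z ^ n) (\<lambda>z. qpoch (g z) (f z)) sequentially"
    using iffD1[OF uniform_limit_cong' h] by simp
  thus "\<exists>d>0. cball a d \<subseteq> S \<and>
          uniform_limit (cball a d) (\<lambda>N z. \<Prod>n<N. 1 - f z * g z ^ n) (\<lambda>z. qpoch (g z) (f z)) sequentially"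
    using d by blast
qed

section \<open>Functional equations, duplication and zeros of the theta function\<close>

lemma theta_1 [simp]: "norm p < 1 \<Longrightarrow> theta p 1 = 0"
  using qpoch_rec[of p 1] by (simp add: theta_def)

lemma theta_reflect [simp]: "p \<noteq> 0 \<Longrightarrow> theta p (p / x) = theta p x"
  by (simp add: theta_def)

lemma theta_inverse:
  assumes "norm p < 1" "x \<noteq> 0"
  shows "theta p (1 / x) = - theta p x / x"
proof -
  have "theta p (1 / x) = (1 - 1 / x) * (qpoch p (p / x) * qpoch p (p * x))"
    using qpoch_rec[OF assms(1), of "1 / x"] by (simp add: theta_def)
  also have "\<dots> = - ((1 - x) * (qpoch p (p * x) * qpoch p (p / x))) / x"
    using assms(2) by (simp add: field_simps)
  finally show ?thesis
    using qpoch_rec[OF assms(1), of x] by (simp add: theta_def)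
qed

lemma theta_shift:
  assumes "norm p < 1" "p \<noteq> 0" "x \<noteq> 0"
  shows "theta p (p * x) = - theta p x / x"
  using theta_reflect[OF assms(2), of "1 / x"] theta_inverse[OF assms(1,3)] by simp

text \<open>\<open>qpoch_duplication\<close> at \<open>x\<close> and at \<open>r / x\<close>. The
  four arguments are the translates of \<open>x\<close> by the two-torsion points \<open>1\<close>,
  \<open>-1\<close>, \<open>r\<close>, \<open>-r\<close> of the curve with period
  \<open>r\<^sup>2\<close>.\<close>

lemma theta_duplication:
  assumes "norm r < 1" "r \<noteq> 0" "x \<noteq> 0"
  shows "theta (r\<^sup>2) (x\<^sup>2)
    = theta (r\<^sup>2) x * theta (r\<^sup>2) (-x) * theta (r\<^sup>2) (r * x) * theta (r\<^sup>2) (- (r * x))"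
proof -
  have "qpoch (r\<^sup>2) (r\<^sup>2 / x\<^sup>2)
      = qpoch (r\<^sup>2) (r / x) * qpoch (r\<^sup>2) (- (r / x)) * qpoch (r\<^sup>2) (r\<^sup>2 / x) * qpoch (r\<^sup>2) (- (r\<^sup>2 / x))"
    using qpoch_duplication[OF assms(1), of "r / x"] by (simp add: power_divide power2_eq_square)
  moreover have "r\<^sup>2 / (r * x) = r / x"
    using assms by (simp add: power2_eq_square)
  ultimately show ?thesis
    using qpoch_duplication[OF assms(1), of x] by (simp add: theta_def mult_ac)
qed

text \<open>Duplication at \<open>r\<close> has \<open>qpoch (r\<^sup>2) (r\<^sup>2)\<close> on both
  sides; cancelling it leaves a product equal to 1 (Euler). The 2 is the first factor
  \<open>1 - (-1)\<close> of the theta value at \<open>-1\<close>.\<close>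

lemma theta_half_periods:
  assumes "norm r < 1" "r \<noteq> 0"
  shows "theta (r\<^sup>2) (-1) * theta (r\<^sup>2) r * theta (r\<^sup>2) (-r) = 2"
proof -
  have p: "norm (r\<^sup>2) < 1"
    using assms by (simp add: norm_power power_less_one_iff)
  have 1: "qpoch (r\<^sup>2) (-(r\<^sup>2)) * qpoch (r\<^sup>2) r * qpoch (r\<^sup>2) (-r) = 1"
    using qpoch_duplication[OF assms(1), of r] qpoch_nonzero[OF p p]
    by (simp add: power2_eq_square mult_ac)
  have "r\<^sup>2 / r = r"
    using assms by (simp add: power2_eq_square)
  hence "theta (r\<^sup>2) (-1) * theta (r\<^sup>2) r * theta (r\<^sup>2) (-r)
    = 2 * (qpoch (r\<^sup>2) (-(r\<^sup>2)) * qpoch (r\<^sup>2) r * qpoch (r\<^sup>2) (-r))\<^sup>2"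
    using qpoch_rec[OF p, of "-1"] by (simp add: theta_def power2_eq_square)
  thus ?thesis by (simp add: 1)
qed

text \<open>Isolates the simple zero at \<open>1\<close>; the cofactor has no zero on the annulus
  below.\<close>

lemma theta_eq_factor:
  assumes "norm p < 1"
  shows "theta p x = (1 - x) * (qpoch p (p * x) * qpoch p (p / x))"
  using qpoch_rec[OF assms, of x] by (simp add: theta_def)

text \<open>For nonzero \<open>p\<close> in the unit disc this ring is two periods wide, and
  \<open>1\<close> is the only zero of \<open>theta p\<close> in it.\<close>

definition annulus :: "complex \<Rightarrow> complex set" where
  "annulus p = {x. norm p < norm x \<and> norm p * norm x < 1}"

lemma theta_cofactor_nonzero:
  assumes "norm p < 1" "x \<in> annulus p"
  shows "qpoch p (p * x) * qpoch p (p / x) \<noteq> 0"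
proof -
  have "x \<noteq> 0" using assms by (auto simp: annulus_def)
  hence "norm (p / x) < 1" "norm (p * x) < 1"
    using assms by (auto simp: annulus_def norm_mult norm_divide)
  thus ?thesis using qpoch_nonzero assms(1) by simp
qed

lemma theta_nonzero:
  assumes "norm p < 1" "x \<in> annulus p" "x \<noteq> 1"
  shows "theta p x \<noteq> 0"
  using theta_cofactor_nonzero[OF assms(1,2)] assms(3) by (simp add: theta_eq_factor[OF assms(1)])

lemma theta_holomorphic [holomorphic_intros]:
  assumes "open S" "f holomorphic_on S" "norm p < 1" "\<And>z. z \<in> S \<Longrightarrow> f z \<noteq> 0"
  shows "(\<lambda>z. theta p (f z)) holomorphic_on S"
  unfolding theta_def by (intro holomorphic_intros assms) (use assms in auto)

subsection \<open>An addition theorem\<close>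

text \<open>The multiplicative form of \<sigma>(x + y) \<sigma>(x - y); the factor \<open>y\<close>
  makes it antisymmetric.\<close>

definition theta_prod :: "complex \<Rightarrow> complex \<Rightarrow> complex \<Rightarrow> complex" where
  "theta_prod p x y = y * theta p (x * y) * theta p (x / y)"

lemma theta_prod_commute:
  assumes "norm p < 1" "x \<noteq> 0" "y \<noteq> 0"
  shows "theta_prod p y x = - theta_prod p x y"
proof -
  have "theta p (y / x) = - theta p (x / y) / (x / y)"
    using theta_inverse[of p "x / y"] assms by simp
  thus ?thesis
    using assms by (simp add: theta_prod_def mult.commute)
qed

lemma theta_prod_self [simp]: "norm p < 1 \<Longrightarrow> x \<noteq> 0 \<Longrightarrow> theta_prod p x x = 0"
  by (simp add: theta_prod_def)

lemma theta_prod_one: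
  assumes "norm p < 1" "x \<noteq> 0"
  shows "theta_prod p x 1 = (theta p x)\<^sup>2" "theta_prod p 1 x = - (theta p x)\<^sup>2"
  using theta_prod_commute[OF assms, of 1] assms
  by (auto simp: theta_prod_def power2_eq_square)

text \<open>The factor \<open>1 / x\<^sup>2\<close> is the one that
  \<open>(theta p x)\<^sup>2\<close> acquires under the same inversion, and likewise under the shift
  by \<open>p\<close>.\<close>

lemma theta_prod_inverse:
  assumes "norm p < 1" "x \<noteq> 0" "y \<noteq> 0"
  shows "theta_prod p (1 / x) y = theta_prod p x y / x\<^sup>2"
proof -
  have "theta p (1 / x * y) = - theta p (x / y) / (x / y)" "theta p (1 / x / y) = - theta p (x * y) / (x * y)"
    using theta_inverse[of p "x / y"] theta_inverse[of p "x * y"] assms by simp_all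
  thus ?thesis
    using assms by (simp only: theta_prod_def) (simp add: power2_eq_square)
qed

lemma theta_prod_shift:
  assumes "norm p < 1" "p \<noteq> 0" "x \<noteq> 0" "y \<noteq> 0"
  shows "theta_prod p (p * x) y = theta_prod p x y / x\<^sup>2"
proof -
  have "theta p (p * x / y) = - theta p (x / y) / (x / y)" "theta p (p * x * y) = - theta p (x * y) / (x * y)"
    using theta_shift[of p "x / y"] theta_shift[of p "x * y"] assms by (simp_all add: mult.assoc)
  thus ?thesis
    using assms by (simp only: theta_prod_def) (simp add: power2_eq_square)
qed

section \<open>Multiplicatively periodic holomorphic functions on the annulus\<close>

lemma open_annulus [simp]: "open (annulus p)"
proof -
  have "annulus p = {x. norm p < norm x} \<inter> {x. norm p * norm x < 1}"
    by (auto simp: annulus_def)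
  thus ?thesis
    by (auto intro!: open_Int open_Collect_less continuous_intros)
qed

lemma connected_annulus_complex:
  assumes "p \<noteq> 0"
  shows "connected (annulus p)"
proof -
  have "annulus p = {x. norm p < norm (x - 0) \<and> norm (x - 0) < 1 / norm p}"
    using assms by (auto simp: annulus_def field_simps)
  thus ?thesis
    using connected_annulus(1)[of "norm p" "0 :: complex" "1 / norm p"] by simp
qed

text \<open>
  By periodicity the maximum of the modulus over the annulus is attained on the compact fundamental
  domain between the radii \<open>sqrt (norm p)\<close> and \<open>1 / sqrt (norm p)\<close>.
\<close>

lemma holomorphic_q_periodic_constant:
  assumes p: "p \<noteq> 0" "norm p < 1" and holo: "h holomorphic_on annulus p"
    and per: "\<And>x. x \<in> annulus p \<Longrightarrow> p * x \<in> annulus p \<Longrightarrow> h (p * x) = h x"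
  shows "h constant_on annulus p"
proof -
  define s where "s = sqrt (norm p)"
  have s: "0 < s" "s < 1" "norm p = s\<^sup>2"
    using p by (auto simp: s_def)
  have s2: "s\<^sup>2 < s"
    using s by (simp add: power2_eq_square)
  define K where "K = {x :: complex. s \<le> norm x \<and> norm x \<le> 1 / s}"
  have "K = cball 0 (1 / s) - ball 0 s"
    by (auto simp: K_def dist_norm)
  hence "compact K"
    by (simp add: compact_diff)
  have "complex_of_real s \<in> K"
    using s mult_le_one[of s s] by (auto simp: K_def field_simps)
  have KA: "K \<subseteq> annulus p"
  proof
    fix x assume "x \<in> K"
    hence "s\<^sup>2 < norm x" "s * norm x \<le> 1"
      using s s2 by (auto simp: K_def field_simps)
    moreover have "s * (s * norm x) \<le> s * 1"
      using s calculation by (intro mult_left_mono) auto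
    hence "s * (s * norm x) < 1"
      using s(2) by linarith
    ultimately show "x \<in> annulus p"
      using s by (simp add: annulus_def power2_eq_square mult.assoc)
  qed
  have "continuous_on K (\<lambda>x. norm (h x))"
    by (intro continuous_on_norm holomorphic_on_imp_continuous_on holomorphic_on_subset[OF holo] KA)
  then obtain \<xi> where \<xi>: "\<xi> \<in> K" "\<And>x. x \<in> K \<Longrightarrow> norm (h x) \<le> norm (h \<xi>)"
    using continuous_attains_sup[OF \<open>compact K\<close>] \<open>complex_of_real s \<in> K\<close> by blast
  have "norm (h x) \<le> norm (h \<xi>)" if x: "x \<in> annulus p" for x
  proof -
    have nx: "s\<^sup>2 < norm x" "s\<^sup>2 * norm x < 1" "x \<noteq> 0"
      using x s by (auto simp: annulus_def)
    \<comment> \<open>Since \<open>norm p = s\<^sup>2\<close>, one division or multiplication by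
      \<open>p\<close> moves every point of the annulus outside \<open>K\<close> into
      \<open>K\<close>.\<close>
    consider "x \<in> K" | "norm x < s" | "norm x > 1 / s"
      by (force simp: K_def)
    thus ?thesis
    proof cases
      case 1
      thus ?thesis by (rule \<xi>)
    next
      case 2
      have "s * s\<^sup>2 \<le> 1 * s\<^sup>2"
        using s by (intro mult_right_mono) auto
      hence "s * s\<^sup>2 \<le> norm x"
        using nx by linarith
      hence "x / p \<in> K"
        using 2 nx s by (simp add: K_def norm_divide field_simps power2_eq_square)
      moreover have "h (p * (x / p)) = h (x / p)"
        using KA calculation p x by (intro per) auto
      ultimately show ?thesis
        using \<xi>(2)[of "x / p"] p by simp
    next
      case 3
      hence "s < s\<^sup>2 * norm x"
        using s by (simp add: field_simps power2_eq_square)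
      moreover have "1 < 1 / s"
        using s by simp
      hence "s\<^sup>2 * norm x \<le> 1 / s"
        using nx(2) by linarith
      ultimately have "p * x \<in> K"
        using s by (simp add: K_def norm_mult)
      thus ?thesis
        using \<xi>(2)[of "p * x"] per[OF x] KA by auto
    qed
  qed
  thus ?thesis
    using maximum_modulus_principle[OF holo open_annulus connected_annulus_complex[OF p(1)] open_annulus order.refl] \<xi>(1) KA
    by blast
qed

text \<open>
  As functions of \<open>x\<close>, a combination \<open>G\<close> of two theta products that vanishes doubly at \<open>1\<close> and
  \<open>theta p x ^ 2\<close> have the same quasi-periodicity, so their quotient is constant.
\<close>

theorem theta_addition:
  assumes p: "p \<noteq> 0" "norm p < 1" and A: "x \<in> annulus p" "y \<in> annulus p" "c \<in> annulus p"
  shows "theta_prod p x y * (theta p c)\<^sup>2 + theta_prod p y c * (theta p x)\<^sup>2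
    + theta_prod p c x * (theta p y)\<^sup>2 = 0"
proof (cases "y = 1")
  \<comment> \<open>Separated because the constant \<open>k\<close> is found below by cancelling
    \<open>(theta p y)\<^sup>2\<close>.\<close>
  case True
  have "x \<noteq> 0" "c \<noteq> 0"
    using A by (auto simp: annulus_def)
  thus ?thesis
    using True p theta_prod_one[of p] by simp
next
  case False
  have nz: "z \<noteq> 0" if "z \<in> annulus p" for z
    using that by (auto simp: annulus_def)
  have y: "y \<noteq> 0" and c: "c \<noteq> 0"
    using A nz by auto
  have one: "1 \<in> annulus p"
    using p by (simp add: annulus_def)
  \<comment> \<open>The weights make the two terms cancel at \<open>1\<close>.\<close>
  define G where "G = (\<lambda>x. theta_prod p x y * (theta p c)\<^sup>2 - theta_prod p x c * (theta p y)\<^sup>2)"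
  have holoG: "G holomorphic_on annulus p"
    unfolding G_def theta_prod_def by (intro holomorphic_intros) (use nz y c p in auto)
  have G1: "G 1 = 0"
    using y c p by (simp add: G_def theta_prod_one)
  have G_inv: "G (1 / z) = G z / z\<^sup>2" and G_shift: "G (p * z) = G z / z\<^sup>2" if "z \<noteq> 0" for z
    using that y c p by (simp_all add: G_def theta_prod_inverse theta_prod_shift diff_divide_distrib)
  \<comment> \<open>Differentiating \<open>G (1 / z) = G z / z\<^sup>2\<close> at \<open>1\<close>,
    where \<open>G\<close> vanishes, gives \<open>- deriv G 1\<close> on the left and
    \<open>deriv G 1\<close> on the right.\<close>
  have dG: "deriv G 1 = 0"
  proof -
    have "G field_differentiable at 1"
      using holomorphic_on_imp_differentiable_at[OF holoG open_annulus one] .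
    hence D: "(G has_field_derivative deriv G 1) (at 1)"
      by (simp add: DERIV_deriv_iff_field_differentiable)
    have "((\<lambda>z. G (1 / z)) has_field_derivative - deriv G 1) (at 1)"
      by (rule DERIV_chain2[where f = G and g = "\<lambda>z. 1 / z", THEN DERIV_cong])
         (use D in \<open>auto intro!: derivative_eq_intros\<close>)
    hence "((\<lambda>z. G z / z\<^sup>2) has_field_derivative - deriv G 1) (at 1)"
      by (rule has_field_derivative_transform_within_open[where S = "-{0}"]) (auto simp: G_inv)
    moreover have "((\<lambda>z. G z / z\<^sup>2) has_field_derivative deriv G 1) (at 1)"
      using D by (auto intro!: derivative_eq_intros simp: G1)
    ultimately have "- deriv G 1 = deriv G 1"
      by (rule DERIV_unique)
    thus ?thesis by simp
  qed
  \<comment> \<open>The zero at \<open>1\<close> is divided out twice; the values at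
    \<open>1\<close> remove the singularities, so \<open>g2\<close> continues
    \<open>G z / (z - 1)\<^sup>2\<close>.\<close>
  define g1 where "g1 = (\<lambda>z. if z = 1 then deriv G 1 else (G z - G 1) / (z - 1))"
  define g2 where "g2 = (\<lambda>z. if z = 1 then deriv g1 1 else (g1 z - g1 1) / (z - 1))"
  have "g2 holomorphic_on annulus p"
    unfolding g2_def g1_def by (intro pole_lemma_open holoG open_annulus)
  define h where "h = (\<lambda>z. g2 z / (qpoch p (p * z) * qpoch p (p / z))\<^sup>2)"
  have h_eq: "h z = G z / (theta p z)\<^sup>2" if "z \<noteq> 1" for z
    using that p by (simp add: h_def theta_eq_factor g1_def g2_def G1 dG power2_eq_square)
      (simp add: field_simps)
  have "h holomorphic_on annulus p"
    unfolding h_def using \<open>g2 holomorphic_on annulus p\<close> theta_cofactor_nonzero[OF p(2)] nz p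
    by (intro holomorphic_intros) auto
  hence "h constant_on annulus p"
  proof (rule holomorphic_q_periodic_constant[OF p])
    fix z assume z: "z \<in> annulus p" "p * z \<in> annulus p"
    \<comment> \<open>Two points of the annulus in ratio \<open>p\<close> both avoid
      \<open>1\<close>, so \<open>h_eq\<close> applies to both.\<close>
    have "z \<noteq> 1"
      using z p by (auto simp: annulus_def norm_mult)
    moreover have "norm (p * z) < 1"
      using z by (simp add: annulus_def norm_mult)
    hence "p * z \<noteq> 1"
      by auto
    ultimately
    show "h (p * z) = h z"
      using nz[OF z(1)] p by (simp add: h_eq G_shift theta_shift power_divide)
  qed
  then obtain k where k: "\<And>z. z \<in> annulus p \<Longrightarrow> h z = k"
    by (auto simp: constant_on_def)
  have G_k: "G z = k * (theta p z)\<^sup>2" if "z \<in> annulus p" for z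
    using k[OF that] h_eq[of z] theta_nonzero[OF p(2) that] G1 p by (cases "z = 1") auto
  \<comment> \<open>At \<open>x = y\<close> the first term of \<open>G\<close> vanishes, which
    evaluates \<open>k\<close>.\<close>
  have "k * (theta p y)\<^sup>2 = - theta_prod p y c * (theta p y)\<^sup>2"
    using G_k[OF A(2)] p y by (simp add: G_def)
  hence "k = - theta_prod p y c"
    using theta_nonzero[OF p(2) A(2) False]
    by (metis mult_right_cancel power_not_zero)
  thus ?thesis
    using G_k[OF A(1)] theta_prod_commute[OF p(2), of x c] nz[OF A(1)] c by (simp add: G_def algebra_simps)
qed

subsection \<open>Half periods\<close>

text \<open>In the sense of elliptic functions this is \<open>\<wp>(y) - \<wp>(x)\<close>, up to normalisation.\<close>

definition theta_diff :: "complex \<Rightarrow> complex \<Rightarrow> complex \<Rightarrow> complex" where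
  "theta_diff p x y = theta_prod p x y / (theta p x * theta p y)\<^sup>2"

text \<open>The addition theorem divided by the squares of the three theta values: differences of
  \<wp>-values telescope.\<close>

lemma theta_diff_add:
  assumes "p \<noteq> 0" "norm p < 1" "x \<in> annulus p - {1}" "y \<in> annulus p - {1}" "c \<in> annulus p - {1}"
  shows "theta_diff p x y + theta_diff p y c = theta_diff p x c"
proof -
  have nz: "theta p x \<noteq> 0" "theta p y \<noteq> 0" "theta p c \<noteq> 0"
    using assms theta_nonzero by auto
  have "x \<noteq> 0" "c \<noteq> 0"
    using assms by (auto simp: annulus_def)
  hence "theta_prod p x y * (theta p c)\<^sup>2 + theta_prod p y c * (theta p x)\<^sup>2
      = theta_prod p x c * (theta p y)\<^sup>2"
    using theta_addition[of p x y c] theta_prod_commute[of p x c] assms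
    by (simp add: add_eq_0_iff2)
  thus ?thesis
    using nz by (simp add: theta_diff_def divide_simps power_mult_distrib)
qed

text \<open>For \<open>h\<close> among \<open>-1\<close>, \<open>r\<close>, \<open>-r\<close> the
  square of \<open>h\<close> is \<open>1\<close> or the period, so \<open>x * h\<close> and
  \<open>x / h\<close> agree modulo the period and the two thetas merge into a square.\<close>

lemma theta_prod_half:
  assumes "norm r < 1" "r \<noteq> 0" "x \<noteq> 0"
  shows "theta_prod (r\<^sup>2) x (-1) = - (theta (r\<^sup>2) (-x))\<^sup>2"
    and "theta_prod (r\<^sup>2) x r = - x * (theta (r\<^sup>2) (r * x))\<^sup>2"
    and "theta_prod (r\<^sup>2) x (-r) = - x * (theta (r\<^sup>2) (- (r * x)))\<^sup>2"
proof -
  have p: "norm (r\<^sup>2) < 1" "r\<^sup>2 \<noteq> 0"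
    using assms by (simp_all add: norm_power power_less_one_iff)
  \<comment> \<open>The \<open>r\<close> bound here is instantiated with both square roots of the
    period.\<close>
  have "r * theta (r\<^sup>2) (x / r) = - x * theta (r\<^sup>2) (r * x)" if "r \<noteq> 0" "norm (r\<^sup>2) < 1" for r
    using theta_shift[of "r\<^sup>2" "x / r"] assms that by (simp add: power2_eq_square)
  from this[of r] this[of "-r"]
  have *: "r * theta (r\<^sup>2) (x / r) = - x * theta (r\<^sup>2) (r * x)"
      "- r * theta (r\<^sup>2) (- (x / r)) = - x * theta (r\<^sup>2) (- (r * x))"
    using assms p by auto
  show "theta_prod (r\<^sup>2) x (-1) = - (theta (r\<^sup>2) (-x))\<^sup>2"
    by (simp add: theta_prod_def power2_eq_square)
  show "theta_prod (r\<^sup>2) x r = - x * (theta (r\<^sup>2) (r * x))\<^sup>2"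
    using arg_cong[OF *(1), of "\<lambda>t. theta (r\<^sup>2) (r * x) * t"]
    by (simp add: theta_prod_def power2_eq_square mult_ac)
  show "theta_prod (r\<^sup>2) x (-r) = - x * (theta (r\<^sup>2) (- (r * x)))\<^sup>2"
    using arg_cong[OF *(2), of "\<lambda>t. theta (r\<^sup>2) (- (r * x)) * t"]
    by (simp add: theta_prod_def power2_eq_square mult_ac)
qed

text \<open>The analogue of \<wp>'^2 = 4 (\<wp> - e1) (\<wp> - e2) (\<wp> - e3): duplication
  collects the numerators into the theta value at \<open>x\<^sup>2\<close>, and the 4 is the square
  of the half-period product.\<close>

lemma theta_diff_half_prod:
  assumes "norm r < 1" "r \<noteq> 0" "x \<in> annulus (r\<^sup>2) - {1}"
  shows "theta_diff (r\<^sup>2) x (-1) * theta_diff (r\<^sup>2) x r * theta_diff (r\<^sup>2) x (-r)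
    = - (x\<^sup>2 * (theta (r\<^sup>2) (x\<^sup>2))\<^sup>2 / (4 * theta (r\<^sup>2) x ^ 8))"
proof -
  have x: "x \<noteq> 0"
    using assms by (auto simp: annulus_def)
  have "theta (r\<^sup>2) x \<noteq> 0"
    using assms theta_nonzero[of "r\<^sup>2" x] by (simp add: norm_power power_less_one_iff)
  moreover have "- (a\<^sup>2) / (t * A)\<^sup>2 * (- x * b\<^sup>2 / (t * B)\<^sup>2) * (- x * c\<^sup>2 / (t * C)\<^sup>2)
      = - (x\<^sup>2 * (t * a * b * c)\<^sup>2 / ((A * B * C)\<^sup>2 * t ^ 8))" if "t \<noteq> 0" for a b c t A B C :: complex
  proof -
    define w where "w = t\<^sup>2"
    have "t ^ 8 = w * (w * w * w)"
      by (simp add: w_def power_add[symmetric])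
    moreover have "w \<noteq> 0"
      using that by (simp add: w_def)
    ultimately show ?thesis
      by (simp add: power_mult_distrib w_def[symmetric] power2_eq_square[of x] mult_ac)
  qed
  ultimately show ?thesis
    by (simp only: theta_diff_def theta_prod_half[OF assms(1,2) x] theta_duplication[OF assms(1,2) x]
          theta_half_periods[OF assms(1,2)]) (simp add: theta_half_periods[OF assms(1,2)])
qed

text \<open>Each difference is a quotient of squared theta values at half periods, up to an
  elementary factor; the product collapses to \<open>- r / 4\<close> by
  \<open>theta_half_periods\<close>.\<close>

lemma theta_diff_half_discriminant:
  assumes "norm r < 1" "r \<noteq> 0"
  shows "(theta_diff (r\<^sup>2) (-1) r * theta_diff (r\<^sup>2) r (-r) * theta_diff (r\<^sup>2) (-1) (-r))\<^sup>2 = r\<^sup>2 / 16"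
proof -
  define A B C where "A = theta (r\<^sup>2) (-1)" "B = theta (r\<^sup>2) r" "C = theta (r\<^sup>2) (-r)"
  have N: "A * B * C = 2"
    using theta_half_periods[OF assms] by (simp add: A_B_C_def)
  hence nz: "A \<noteq> 0" "B \<noteq> 0" "C \<noteq> 0"
    by auto
  have p: "norm (r\<^sup>2) < 1" "r\<^sup>2 \<noteq> 0"
    using assms by (simp_all add: norm_power power_less_one_iff)
  have "theta (r\<^sup>2) (- (r * r)) = A"
    using theta_shift[OF p, of "-1"] by (simp add: A_B_C_def power2_eq_square)
  hence "theta_diff (r\<^sup>2) (-1) r * theta_diff (r\<^sup>2) r (-r) * theta_diff (r\<^sup>2) (-1) (-r)
    = C\<^sup>2 / (A * B)\<^sup>2 * (- r * A\<^sup>2 / (B * C)\<^sup>2) * (B\<^sup>2 / (A * C)\<^sup>2)"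
    using theta_prod_half(2,3)[OF assms, of "-1"] theta_prod_half(3)[OF assms, of r] assms
    by (simp only: theta_diff_def A_B_C_def[symmetric]) (simp add: A_B_C_def)
  also have "\<dots> = - r / (A * B * C)\<^sup>2"
    using nz by (simp add: power2_eq_square)
  also have "\<dots>\<^sup>2 = r\<^sup>2 / 16"
    by (simp add: N power_divide)
  finally show ?thesis .
qed

text \<open>
  The prescribed products are the values of a monic cubic at three points, normalised so that two of
  the points are \<open>0\<close> and \<open>1\<close>; below, \<open>x = X / Z\<close> and \<open>y = Y / Z\<close>.
\<close>

lemma cubic_discriminant_parametrized:
  fixes x y e1 e2 e3 :: "'a :: field_char_0"
  assumes "x \<noteq> 0" "y \<noteq> 0" "y = x + 1"
    and "e1 * e2 * e3 = y ^ 3 / (4 * x\<^sup>2)"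
    and "(e1 - 1) * (e2 - 1) * (e3 - 1) = 1 / (4 * y)"
    and "(e1 - y / x) * (e2 - y / x) * (e3 - y / x) = y / (4 * x ^ 4)"
  shows "((e1 - e2) * (e2 - e3) * (e1 - e3))\<^sup>2 = y * (x ^ 3 - 5 * x\<^sup>2 - 8 * x - 1) / (16 * x ^ 5)"
proof -
  define s t u where "s = e1 + e2 + e3" "t = e1 * e2 + e2 * e3 + e1 * e3" "u = e1 * e2 * e3"
  \<comment> \<open>The value at \<open>0\<close> gives \<open>u\<close>; those at \<open>1\<close>
    and \<open>y / x\<close> give the linear equations \<open>s - t = A\<close> and
    \<open>s * (y / x) - t = B\<close>, solvable since \<open>y / x - 1 = 1 / x\<close>.\<close>
  define A where "A = 1 / (4 * y) - u + 1"
  define B where "B = x / y * (y / (4 * x ^ 4) - u + (y / x) ^ 3)"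
  have u: "u = y ^ 3 / (4 * x\<^sup>2)"
    using assms by (simp add: s_t_u_def)
  have "u - t + s - 1 = 1 / (4 * y)"
    unfolding assms(5)[symmetric] s_t_u_def by (simp add: algebra_simps)
  hence 1: "s - t = A"
    by (simp add: A_def algebra_simps)
  have "(e1 - c) * (e2 - c) * (e3 - c) = u - t * c + s * c\<^sup>2 - c ^ 3" for c
    unfolding s_t_u_def by algebra
  hence "u - t * (y / x) + s * (y / x)\<^sup>2 - (y / x) ^ 3 = y / (4 * x ^ 4)"
    using assms(6) by simp
  hence "y / x * (s * (y / x) - t) = y / (4 * x ^ 4) - u + (y / x) ^ 3"
    by (simp add: algebra_simps power2_eq_square)
  hence 2: "s * (y / x) - t = B"
    using assms(1,2) by (simp add: B_def field_simps)
  have "s * (y / x - 1) = B - A"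
    unfolding 1[symmetric] 2[symmetric] by (simp add: algebra_simps)
  hence s: "s = x * (B - A)"
    using assms(1,3) by (simp add: field_simps)
  have t: "t = s - A"
    using 1 by (simp add: algebra_simps)
  \<comment> \<open>Numerators of the solution: \<open>s = S / (4 * x\<^sup>2 * y)\<close> and
    \<open>t = y * W / (2 * x\<^sup>2)\<close>.\<close>
  define S W where "S = 1 + 6 * x + 15 * x\<^sup>2 + 10 * x ^ 3 + x ^ 4" "W = x\<^sup>2 + 3 * x + 1"
  have A: "4 * x\<^sup>2 * y * A = x\<^sup>2 - y ^ 4 + 4 * x\<^sup>2 * y"
    using assms(1,2) unfolding A_def u by (simp add: field_simps eval_nat_numeral)
  have B: "4 * x ^ 3 * B = 1 - x\<^sup>2 * y\<^sup>2 + 4 * x * y\<^sup>2"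
    using assms(1,2) unfolding B_def u by (simp add: field_simps eval_nat_numeral)
  have "4 * x\<^sup>2 * y * s = y * (4 * x ^ 3 * B) - x * (4 * x\<^sup>2 * y * A)"
    unfolding s by algebra
  also have "\<dots> = S"
    unfolding A B unfolding S_W_def assms(3) by algebra
  finally have S: "4 * x\<^sup>2 * y * s = S" .
  have "2 * y * (2 * x\<^sup>2 * t) = 4 * x\<^sup>2 * y * s - 4 * x\<^sup>2 * y * A"
    unfolding t by algebra
  also have "\<dots> = 2 * y * (y * W)"
    unfolding A S unfolding S_W_def assms(3) by algebra
  finally have W: "2 * x\<^sup>2 * t = y * W"
    using assms(2) by (simp add: mult_ac)
  have st: "s = S / (4 * x\<^sup>2 * y)" "t = y * W / (2 * x\<^sup>2)"
    using assms(1,2) S W by (simp_all add: eq_divide_eq mult_ac)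
  \<comment> \<open>The discriminant in elementary symmetric functions; its five terms are then put
    over the common denominator \<open>256 * x ^ 8\<close>.\<close>
  have "((e1 - e2) * (e2 - e3) * (e1 - e3))\<^sup>2
      = s\<^sup>2 * t\<^sup>2 - 4 * t ^ 3 - 4 * s ^ 3 * u + 18 * s * t * u - 27 * u\<^sup>2"
    unfolding s_t_u_def by algebra
  moreover have "s\<^sup>2 * t\<^sup>2 = 4 * S\<^sup>2 * W\<^sup>2 / (256 * x ^ 8)"
    using assms(1,2) unfolding st by (simp add: divide_simps eval_nat_numeral)
  moreover have "4 * t ^ 3 = 128 * x\<^sup>2 * y ^ 3 * W ^ 3 / (256 * x ^ 8)"
    using assms(1,2) unfolding st by (simp add: divide_simps eval_nat_numeral)
  moreover have "4 * s ^ 3 * u = 4 * S ^ 3 / (256 * x ^ 8)"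
    using assms(1,2) unfolding st u by (simp add: divide_simps eval_nat_numeral)
  moreover have "18 * s * t * u = 144 * x\<^sup>2 * S * W * y ^ 3 / (256 * x ^ 8)"
    using assms(1,2) unfolding st u by (simp add: divide_simps eval_nat_numeral)
  moreover have "27 * u\<^sup>2 = 432 * x ^ 4 * y ^ 6 / (256 * x ^ 8)"
    using assms(1,2) unfolding u by (simp add: divide_simps eval_nat_numeral)
  ultimately have "((e1 - e2) * (e2 - e3) * (e1 - e3))\<^sup>2
      = (4 * S\<^sup>2 * W\<^sup>2 - 128 * x\<^sup>2 * y ^ 3 * W ^ 3 - 4 * S ^ 3
      + 144 * x\<^sup>2 * S * W * y ^ 3 - 432 * x ^ 4 * y ^ 6) / (256 * x ^ 8)"
    by (simp only: add_divide_distrib diff_divide_distrib)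
  also have "4 * S\<^sup>2 * W\<^sup>2 - 128 * x\<^sup>2 * y ^ 3 * W ^ 3 - 4 * S ^ 3
      + 144 * x\<^sup>2 * S * W * y ^ 3 - 432 * x ^ 4 * y ^ 6
      = 16 * x ^ 3 * y * (x ^ 3 - 5 * x\<^sup>2 - 8 * x - 1)"
    unfolding assms(3) S_W_def by algebra
  also have "\<dots> / (256 * x ^ 8) = y * (x ^ 3 - 5 * x\<^sup>2 - 8 * x - 1) / (16 * x ^ 5)"
    using assms(1) by (simp add: divide_simps eval_nat_numeral)
  finally show ?thesis .
qed

subsection \<open>Theta values at seven-torsion points\<close>

text \<open>Unlike \<open>theta (q ^ 7) (q ^ k)\<close>, this form is holomorphic at \<open>q = 0\<close>.\<close>

definition theta7 :: "nat \<Rightarrow> complex \<Rightarrow> complex" where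
  "theta7 k q = qpoch (q ^ 7) (q ^ k) * qpoch (q ^ 7) (q ^ (7 - k))"

lemma norm_power_less_1:
  fixes q :: "'a :: real_normed_div_algebra"
  assumes "norm q < 1" "k > 0"
  shows "norm (q ^ k) < 1"
  using assms by (simp add: norm_power power_less_one_iff)

lemma theta7_0 [simp]: "0 < k \<Longrightarrow> k < 7 \<Longrightarrow> theta7 k 0 = 1"
  by (simp add: theta7_def power_0_left)

lemma theta7_nonzero:
  assumes "norm q < 1" "0 < k" "k < 7"
  shows "theta7 k q \<noteq> 0"
  using assms by (simp add: theta7_def qpoch_nonzero norm_power_less_1)

lemma theta7_holomorphic [holomorphic_intros]:
  "theta7 k holomorphic_on ball 0 1"
  unfolding theta7_def[abs_def] by (intro holomorphic_intros) (auto simp: norm_power_less_1)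

lemma theta_eq_theta7:
  assumes "q \<noteq> 0" "k \<le> 7"
  shows "theta (q ^ 7) (q ^ k) = theta7 k q"
  using assms by (simp add: theta_def theta7_def power_diff)

text \<open>Exponents sorted modulo 7: the residues \<open>k\<close> and \<open>7 - k\<close> pair
  into \<open>theta7 k q\<close>, and the multiples of 7 remain.\<close>

lemma qpoch_eq_theta7:
  assumes "norm q < 1"
  shows "qpoch q q = theta7 1 q * theta7 2 q * theta7 3 q * qpoch (q ^ 7) (q ^ 7)"
  using qpoch_dissect[OF assms, of 7 q]
  by (simp add: theta7_def lessThan_Suc numeral_eq_Suc mult_ac)

context
  fixes q a b c :: complex
  assumes q: "q \<noteq> 0" "norm q < 1"
  defines "a \<equiv> theta7 1 q" and "b \<equiv> theta7 2 q" and "c \<equiv> theta7 3 q"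
begin

lemma theta7_nz: "a \<noteq> 0" "b \<noteq> 0" "c \<noteq> 0"
  using q by (auto simp: a_def b_def c_def theta7_nonzero)

lemma power_in_annulus:
  assumes "0 < k" "k < 7"
  shows "q ^ k \<in> annulus (q ^ 7) - {1}"
proof -
  have "norm (q ^ k) < 1" "norm (q ^ 7 * q ^ k) < 1"
    using assms q by (auto simp flip: power_add intro: norm_power_less_1)
  moreover have "norm (q ^ 7) < norm (q ^ k)"
    using assms q by (simp add: norm_power)
  ultimately show ?thesis
    by (auto simp: annulus_def norm_mult)
qed

lemma theta_values:
  "theta (q ^ 7) (q ^ 2) = b" "theta (q ^ 7) (q ^ 3) = c" "theta (q ^ 7) (q ^ 4) = c"
  "theta (q ^ 7) (q ^ 5) = b" "theta (q ^ 7) (q ^ 6) = a" "theta (q ^ 7) q = a"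
  "theta (q ^ 7) (1 / q) = - a / q"
proof -
  show a: "theta (q ^ 7) q = a"
    using theta_eq_theta7[of q 1] q by (simp add: a_def b_def c_def)
  show "theta (q ^ 7) (1 / q) = - a / q"
    using theta_inverse[of "q ^ 7" q] q a by (simp add: norm_power_less_1)
qed (use q in \<open>simp_all add: theta_eq_theta7 a_def b_def c_def theta7_def mult.commute\<close>)

lemma theta_diff_values:
  "theta_diff (q ^ 7) q (q ^ 2) = - (q * c / (a * b\<^sup>2))"
  "theta_diff (q ^ 7) (q ^ 2) (q ^ 3) = - (q\<^sup>2 * a / (b * c\<^sup>2))"
  "theta_diff (q ^ 7) q (q ^ 3) = - (q * b / (c * a\<^sup>2))"
proof -
  have "q * q ^ 2 = q ^ 3" "q / q ^ 2 = 1 / q" "q ^ 2 * q ^ 3 = q ^ 5" "q ^ 2 / q ^ 3 = 1 / q"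
      "q ^ 3 * q = q ^ 4" "q ^ 3 / q = q ^ 2"
    using q by (simp_all add: eval_nat_numeral)
  note * = this
  show "theta_diff (q ^ 7) q (q ^ 2) = - (q * c / (a * b\<^sup>2))"
    using q theta7_nz by (simp only: theta_diff_def theta_prod_def * theta_values)
      (simp add: field_simps power2_eq_square)
  show "theta_diff (q ^ 7) (q ^ 2) (q ^ 3) = - (q\<^sup>2 * a / (b * c\<^sup>2))"
    using q theta7_nz by (simp only: theta_diff_def theta_prod_def * theta_values)
      (simp add: field_simps eval_nat_numeral)
  \<comment> \<open>Swapping the arguments replaces \<open>q / q ^ 3\<close> by
    \<open>q ^ 2\<close>, whose theta value is listed.\<close>
  have "theta_diff (q ^ 7) q (q ^ 3) = - theta_diff (q ^ 7) (q ^ 3) q"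
    using theta_prod_commute[of "q ^ 7" "q ^ 3" q] q
    by (simp add: theta_diff_def norm_power_less_1 mult.commute)
  also have "\<dots> = - (q * b / (c * a\<^sup>2))"
    using q theta7_nz by (simp only: theta_diff_def theta_prod_def * theta_values)
      (simp add: field_simps power2_eq_square)
  finally show "theta_diff (q ^ 7) q (q ^ 3) = - (q * b / (c * a\<^sup>2))" .
qed

text \<open>The telescoping relation at \<open>q\<close>, \<open>q ^ 2\<close>,
  \<open>q ^ 3\<close>, cleared of the common factor \<open>q / (a * b * c)\<^sup>2\<close>.\<close>

lemma theta7_klein_quartic: "b ^ 3 * c = c ^ 3 * a + q * a ^ 3 * b"
proof -
  have "theta_diff (q ^ 7) q (q ^ 2) + theta_diff (q ^ 7) (q ^ 2) (q ^ 3) = theta_diff (q ^ 7) q (q ^ 3)"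
    using theta_diff_add[of "q ^ 7" q "q ^ 2" "q ^ 3"] power_in_annulus[of 1] power_in_annulus[of 2]
      power_in_annulus[of 3] q by (simp add: norm_power_less_1)
  hence "q * c / (a * b\<^sup>2) + q\<^sup>2 * a / (b * c\<^sup>2) = q * b / (c * a\<^sup>2)"
    unfolding theta_diff_values by (simp add: algebra_simps)
  moreover have "q * c / (a * b\<^sup>2) = q * (c ^ 3 * a) / (a * b * c)\<^sup>2"
      "q\<^sup>2 * a / (b * c\<^sup>2) = q * (q * a ^ 3 * b) / (a * b * c)\<^sup>2"
      "q * b / (c * a\<^sup>2) = q * (b ^ 3 * c) / (a * b * c)\<^sup>2"
    using theta7_nz q by (simp_all add: divide_simps eval_nat_numeral)
  ultimately show ?thesis
    using theta7_nz q by (simp add: add_divide_distrib[symmetric] distrib_left[symmetric])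
qed

text \<open>The discriminant of the half-period cubic is computed twice, from its values at three
  points and directly from the half periods; equating the two gives the relation.\<close>

lemma theta7_eta_relation:
  defines "X \<equiv> c ^ 3 * a" and "Z \<equiv> q * a ^ 3 * b"
  shows "(a * b * c) ^ 8 = X ^ 3 - 5 * X\<^sup>2 * Z - 8 * X * Z\<^sup>2 - Z ^ 3"
proof -
  \<comment> \<open>A square root of the period \<open>q ^ 7\<close>; the other choice only
    exchanges \<open>r\<close> and \<open>-r\<close>.\<close>
  define r where "r = csqrt q ^ 7"
  have "r\<^sup>2 = (csqrt q)\<^sup>2 ^ 7"
    unfolding r_def by (simp only: power_mult[symmetric] mult.commute)
  hence r: "r\<^sup>2 = q ^ 7" "r \<noteq> 0"
    using q by (simp_all add: r_def)
  have p: "norm (q ^ 7) < 1" and p0: "q ^ 7 \<noteq> 0"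
    using q by (simp_all add: norm_power_less_1)
  have nr: "norm r < 1"
  proof -
    have "(norm r)\<^sup>2 < 1"
      using p r(1) by (metis norm_power)
    thus ?thesis by (simp add: power_less_one_iff)
  qed
  have half: "-1 \<in> annulus (q ^ 7) - {1}" "r \<in> annulus (q ^ 7) - {1}" "-r \<in> annulus (q ^ 7) - {1}"
  proof -
    have "(norm r)\<^sup>2 < norm r" "(norm r)\<^sup>2 * norm r < 1"
      using nr r(2) norm_power_less_1[of r 3] by (auto simp: power2_eq_square power3_eq_cube norm_mult)
    moreover have "- r \<noteq> 1"
      using nr by (metis less_irrefl norm_minus_cancel norm_one)
    ultimately show "-1 \<in> annulus (q ^ 7) - {1}" "r \<in> annulus (q ^ 7) - {1}" "-r \<in> annulus (q ^ 7) - {1}"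
      using nr by (auto simp: annulus_def norm_power simp flip: r(1))
  qed
  \<comment> \<open>Dividing by \<open>D\<close> puts \<open>q\<close>, \<open>q ^ 2\<close>,
    \<open>q ^ 3\<close> at \<open>0\<close>, \<open>1\<close>, \<open>y / x\<close>, as the cubic
    lemma requires.\<close>
  define D where "D = - (q * c / (a * b\<^sup>2))"
  define x y where "x = c ^ 3 / (q * a\<^sup>2 * b)" "y = b\<^sup>2 * c / (q * a ^ 3)"
  have nz: "x \<noteq> 0" "y \<noteq> 0" "D \<noteq> 0"
    using q theta7_nz by (auto simp: x_y_def D_def)
  have xy: "y = x + 1"
  proof -
    have "y = b ^ 3 * c / (q * a ^ 3 * b)"
      using q theta7_nz by (simp add: x_y_def divide_simps eval_nat_numeral)
    also have "\<dots> = x + 1"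
      unfolding theta7_klein_quartic using q theta7_nz by (simp add: x_y_def field_simps eval_nat_numeral)
    finally show ?thesis .
  qed
  have D: "theta_diff (q ^ 7) q (q ^ 2) = D" "theta_diff (q ^ 7) q (q ^ 3) = D * (y / x)"
    unfolding theta_diff_values using q theta7_nz
    by (simp_all add: x_y_def D_def divide_simps eval_nat_numeral)
  define e where "e = (\<lambda>w. theta_diff (q ^ 7) q w / D)"
  have e: "theta_diff (q ^ 7) q w = D * e w" for w
    using nz by (simp add: e_def)
  have pts: "q \<in> annulus (q ^ 7) - {1}" "q ^ 2 \<in> annulus (q ^ 7) - {1}" "q ^ 3 \<in> annulus (q ^ 7) - {1}"
    using power_in_annulus[of 1] power_in_annulus[of 2] power_in_annulus[of 3] by simp_all
  have e2: "theta_diff (q ^ 7) (q ^ 2) w = D * (e w - 1)"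
    and e3: "theta_diff (q ^ 7) (q ^ 3) w = D * (e w - y / x)"
    if "w \<in> annulus (q ^ 7) - {1}" for w
  proof -
    have "D + theta_diff (q ^ 7) (q ^ 2) w = D * e w"
      by (rule theta_diff_add[OF p0 p pts(1,2) that, unfolded D, unfolded e])
    thus "theta_diff (q ^ 7) (q ^ 2) w = D * (e w - 1)"
      by (simp add: algebra_simps)
    have "D * (y / x) + theta_diff (q ^ 7) (q ^ 3) w = D * e w"
      by (rule theta_diff_add[OF p0 p pts(1,3) that, unfolded D, unfolded e])
    thus "theta_diff (q ^ 7) (q ^ 3) w = D * (e w - y / x)"
      by (simp add: algebra_simps)
  qed
  \<comment> \<open>Used at \<open>q\<close>, \<open>q ^ 2\<close>, \<open>q ^ 3\<close>, whose
    squares have theta values \<open>b\<close>, \<open>c\<close>, \<open>a\<close>: doubling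
    permutes the three.\<close>
  have prod: "theta_diff (q ^ 7) z (-1) * theta_diff (q ^ 7) z r * theta_diff (q ^ 7) z (-r)
      = - (z\<^sup>2 * (theta (q ^ 7) (z\<^sup>2))\<^sup>2 / (4 * theta (q ^ 7) z ^ 8))"
    if "z \<in> annulus (q ^ 7) - {1}" for z
    using theta_diff_half_prod[OF nr r(2)] that r(1) by metis
  have cancel: "s = t" if "D ^ 3 * s = D ^ 3 * t" for s t
    using that nz by simp
  have "D ^ 3 * (e (-1) * e r * e (-r)) = - (q\<^sup>2 * b\<^sup>2 / (4 * a ^ 8))"
    using prod[OF pts(1)] by (simp add: e theta_values power3_eq_cube mult_ac)
  also have "\<dots> = D ^ 3 * (y ^ 3 / (4 * x\<^sup>2))"
    using q theta7_nz by (simp add: x_y_def D_def divide_simps eval_nat_numeral)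
  finally have P1: "e (-1) * e r * e (-r) = y ^ 3 / (4 * x\<^sup>2)"
    by (rule cancel)
  have "(q\<^sup>2)\<^sup>2 = q ^ 4" "(q ^ 3)\<^sup>2 = q ^ 6"
    by (simp_all flip: power_mult)
  note qq = this
  have "D ^ 3 * ((e (-1) - 1) * (e r - 1) * (e (-r) - 1)) = - (q ^ 4 * c\<^sup>2 / (4 * b ^ 8))"
    using prod[OF pts(2)] unfolding half[THEN e2] qq theta_values by (simp add: power3_eq_cube mult_ac)
  also have "\<dots> = D ^ 3 * (1 / (4 * y))"
    using q theta7_nz by (simp add: x_y_def D_def divide_simps eval_nat_numeral)
  finally have P2: "(e (-1) - 1) * (e r - 1) * (e (-r) - 1) = 1 / (4 * y)"
    by (rule cancel)
  have "D ^ 3 * ((e (-1) - y / x) * (e r - y / x) * (e (-r) - y / x)) = - (q ^ 6 * a\<^sup>2 / (4 * c ^ 8))"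
    using prod[OF pts(3)] unfolding half[THEN e3] qq theta_values by (simp add: power3_eq_cube mult_ac)
  also have "\<dots> = D ^ 3 * (y / (4 * x ^ 4))"
    using q theta7_nz by (simp add: x_y_def D_def divide_simps eval_nat_numeral)
  finally have P3: "(e (-1) - y / x) * (e r - y / x) * (e (-r) - y / x) = y / (4 * x ^ 4)"
    by (rule cancel)
  have diff: "theta_diff (q ^ 7) v w = D * (e w - e v)"
    if "v \<in> annulus (q ^ 7) - {1}" "w \<in> annulus (q ^ 7) - {1}" for v w
    using theta_diff_add[OF p0 p pts(1) that] by (simp add: e algebra_simps)
  have "q ^ 7 / 16 = (D * (e r - e (-1)) * (D * (e (-r) - e r)) * (D * (e (-r) - e (-1))))\<^sup>2"
    using theta_diff_half_discriminant[OF nr r(2)] unfolding r(1) by (simp only: diff half)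
  also have "\<dots> = D ^ 6 * ((e (-1) - e r) * (e r - e (-r)) * (e (-1) - e (-r)))\<^sup>2"
    by algebra
  also have "\<dots> = D ^ 6 * (y * (x ^ 3 - 5 * x\<^sup>2 - 8 * x - 1) / (16 * x ^ 5))"
    using cubic_discriminant_parametrized[OF nz(1,2) xy P1 P2 P3] by simp
  finally have "x ^ 3 - 5 * x\<^sup>2 - 8 * x - 1 = q ^ 7 * x ^ 5 / (D ^ 6 * y)"
    using nz by (simp add: divide_simps)
  moreover have "Z ^ 3 * (q ^ 7 * x ^ 5 / (D ^ 6 * y)) = (a * b * c) ^ 8"
    using q theta7_nz by (simp add: x_y_def D_def Z_def divide_simps eval_nat_numeral)
  moreover have "X = Z * x"
    using q theta7_nz by (simp add: X_def Z_def x_y_def eval_nat_numeral)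
  hence "X ^ 3 - 5 * X\<^sup>2 * Z - 8 * X * Z\<^sup>2 - Z ^ 3 = Z ^ 3 * (x ^ 3 - 5 * x\<^sup>2 - 8 * x - 1)"
    by algebra
  ultimately show ?thesis by simp
qed

end

subsection \<open>The cube root of $j_7^*$\<close>

text \<open>The left side of the first claim over \<open>2 * eta \<tau> ^ 2\<close>, times q^(1/3).
  Removing the fractional power leaves a function holomorphic at \<open>q = 0\<close>.\<close>

definition cube_root_factor :: "complex \<Rightarrow> complex" where
  "cube_root_factor q = (theta7 3 q ^ 4 / theta7 2 q ^ 2 + q\<^sup>2 * theta7 1 q ^ 4 / theta7 3 q ^ 2
     + theta7 2 q ^ 4 / theta7 1 q ^ 2) / (2 * (theta7 1 q * theta7 2 q * theta7 3 q)\<^sup>2)"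

lemma cube_root_factor_0 [simp]: "cube_root_factor 0 = 1"
  by (simp add: cube_root_factor_def)

lemma cube_root_factor_holomorphic: "cube_root_factor holomorphic_on ball 0 1"
  unfolding cube_root_factor_def[abs_def]
  by (intro holomorphic_intros) (auto simp: theta7_nonzero)

text \<open>The first right side is \<open>q\<close> times \<open>j7star\<close>; the second
  identity prepares the sum of reciprocals. Both rest on
  \<open>M ^ 4 * K = X\<^sup>2 + X * Z + Z\<^sup>2\<close>.\<close>

lemma cube_root_factor_identities:
  fixes q :: complex
  assumes q: "q \<noteq> 0" "norm q < 1"
  defines "a \<equiv> theta7 1 q" and "b \<equiv> theta7 2 q" and "c \<equiv> theta7 3 q"
  shows "cube_root_factor q ^ 3 = (a * b * c) ^ 4 + 13 * q + 49 * q\<^sup>2 / (a * b * c) ^ 4"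
    and "q\<^sup>2 * (b\<^sup>2 / c ^ 4) + c\<^sup>2 / a ^ 4 + q\<^sup>2 * (a\<^sup>2 / b ^ 4) = (a * b * c)\<^sup>2 * cube_root_factor q ^ 2"
proof -
  have nz: "a \<noteq> 0" "b \<noteq> 0" "c \<noteq> 0"
    using q by (auto simp: a_def b_def c_def theta7_nonzero)
  define M X Y Z K where "M = a * b * c" "X = c ^ 3 * a" "Y = b ^ 3 * c" "Z = q * a ^ 3 * b"
    "K = cube_root_factor q"
  have M: "M \<noteq> 0"
    using nz by (simp add: M_X_Y_Z_K_def)
  have klein: "Y = X + Z"
    using theta7_klein_quartic[OF q] by (simp add: M_X_Y_Z_K_def a_def b_def c_def)
  have rel: "M ^ 8 = X ^ 3 - 5 * X\<^sup>2 * Z - 8 * X * Z\<^sup>2 - Z ^ 3"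
    using theta7_eta_relation[OF q] by (simp only: M_X_Y_Z_K_def a_def b_def c_def)
  have XYZ: "X * Y * Z = q * M ^ 4"
    by (simp add: M_X_Y_Z_K_def eval_nat_numeral)
  have "c ^ 4 / b ^ 2 = X\<^sup>2 / M\<^sup>2" "q\<^sup>2 * a ^ 4 / c ^ 2 = Z\<^sup>2 / M\<^sup>2" "b ^ 4 / a ^ 2 = Y\<^sup>2 / M\<^sup>2"
    using nz by (simp_all add: M_X_Y_Z_K_def divide_simps eval_nat_numeral)
  hence "K = (X\<^sup>2 / M\<^sup>2 + Z\<^sup>2 / M\<^sup>2 + Y\<^sup>2 / M\<^sup>2) / (2 * M\<^sup>2)"
    unfolding M_X_Y_Z_K_def(5) cube_root_factor_def a_def[symmetric] b_def[symmetric] c_def[symmetric]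
    by (simp add: M_X_Y_Z_K_def(1))
  hence "2 * M ^ 4 * K = X\<^sup>2 + Z\<^sup>2 + Y\<^sup>2"
    using M by (simp add: field_simps eval_nat_numeral)
  moreover have "X\<^sup>2 + Z\<^sup>2 + Y\<^sup>2 = 2 * (X\<^sup>2 + X * Z + Z\<^sup>2)"
    unfolding klein by algebra
  ultimately have "2 * (M ^ 4 * K) = 2 * (X\<^sup>2 + X * Z + Z\<^sup>2)"
    by (simp only: mult.assoc)
  hence K: "M ^ 4 * K = X\<^sup>2 + X * Z + Z\<^sup>2"
    by (rule mult_left_cancel[THEN iffD1, rotated]) simp
  have "M ^ 12 * K ^ 3 = (M ^ 4 * K) ^ 3"
    by algebra
  \<comment> \<open>The factor \<open>M ^ 12\<close> and \<open>X * Y * Z = q * M ^ 4\<close> turn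
    the claim into a homogeneous identity of degree six in \<open>X\<close> and
    \<open>Z\<close>.\<close>
  also have "\<dots> = (M ^ 8)\<^sup>2 + 13 * (X * Y * Z) * M ^ 8 + 49 * (X * Y * Z)\<^sup>2"
    unfolding K rel klein by algebra
  also have "\<dots> = M ^ 12 * (M ^ 4 + 13 * q + 49 * q\<^sup>2 / M ^ 4)"
    unfolding XYZ using M by (simp add: field_simps)
  finally show "cube_root_factor q ^ 3 = (a * b * c) ^ 4 + 13 * q + 49 * q\<^sup>2 / (a * b * c) ^ 4"
    using M by (simp add: M_X_Y_Z_K_def)
  have "q\<^sup>2 * (b\<^sup>2 / c ^ 4) = (Y * Z)\<^sup>2 / M ^ 6" "c\<^sup>2 / a ^ 4 = (X * Y)\<^sup>2 / M ^ 6"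
      "q\<^sup>2 * (a\<^sup>2 / b ^ 4) = (X * Z)\<^sup>2 / M ^ 6"
    using nz by (simp_all add: M_X_Y_Z_K_def divide_simps eval_nat_numeral)
  hence "q\<^sup>2 * (b\<^sup>2 / c ^ 4) + c\<^sup>2 / a ^ 4 + q\<^sup>2 * (a\<^sup>2 / b ^ 4)
      = ((Y * Z)\<^sup>2 + (X * Y)\<^sup>2 + (X * Z)\<^sup>2) / M ^ 6"
    by (simp add: add_divide_distrib)
  also have "(Y * Z)\<^sup>2 + (X * Y)\<^sup>2 + (X * Z)\<^sup>2 = (M ^ 4 * K)\<^sup>2"
    unfolding K klein by algebra
  also have "\<dots> / M ^ 6 = M\<^sup>2 * K\<^sup>2"
    using M by (simp add: divide_simps eval_nat_numeral)
  finally show "q\<^sup>2 * (b\<^sup>2 / c ^ 4) + c\<^sup>2 / a ^ 4 + q\<^sup>2 * (a\<^sup>2 / b ^ 4) = (a * b * c)\<^sup>2 * cube_root_factor q ^ 2"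
    by (simp only: M_X_Y_Z_K_def)
qed

section \<open>Fractional powers of \<open>q\<close> on the upper half-plane\<close>

lemma qpow_nonzero [simp]: "qpow \<alpha> \<tau> \<noteq> 0"
  by (simp add: qpow_def)

lemma qpow_of_nat_mult: "qpow (of_nat n * \<alpha>) \<tau> = qpow \<alpha> \<tau> ^ n"
  unfolding qpow_def exp_of_nat_mult[symmetric] by (simp add: mult_ac)

lemma qpow_holomorphic [holomorphic_intros]: "qpow \<alpha> holomorphic_on S"
  unfolding qpow_def[abs_def] by (intro holomorphic_intros)

lemma norm_qq: "norm (qq \<tau>) = exp (- (2 * pi * Im \<tau>))"
  by (simp add: qq_def qpow_def)

lemma norm_qq_less_1: "\<tau> \<in> uhp \<Longrightarrow> norm (qq \<tau>) < 1"
  by (simp add: norm_qq uhp_def)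

lemma qq_nonzero [simp]: "qq \<tau> \<noteq> 0"
  by (simp add: qq_def)

lemma qq_tendsto_0: "(qq \<longlongrightarrow> 0) at_i_infinity"
proof -
  have "((\<lambda>y. exp (- (2 * pi * y))) \<longlongrightarrow> 0) at_top"
    by real_asymp
  hence "((\<lambda>\<tau>. norm (qq \<tau>)) \<longlongrightarrow> 0) at_i_infinity"
    unfolding norm_qq at_i_infinity_def
    by (rule filterlim_compose[OF _ filterlim_filtercomap, of "\<lambda>y. exp (- (2 * pi * y))"])
  thus ?thesis
    by (rule tendsto_norm_zero_cancel)
qed

lemma prodinf_theta7:
  assumes "norm q < 1" "k \<le> 7"
  shows "(\<Prod>n. (1 - q ^ (7 * n + k)) * (1 - q ^ (7 * n + (7 - k))) * (1 - q ^ (7 * n + 7)))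
    = theta7 k q * qpoch (q ^ 7) (q ^ 7)"
proof -
  have p: "norm (q ^ 7) < 1"
    using assms by (simp add: norm_power_less_1)
  have "1 - q ^ (7 * n + j) = 1 - q ^ j * (q ^ 7) ^ n" for n j
    by (simp add: power_add power_mult)
  hence "(\<Prod>n. (1 - q ^ (7 * n + k)) * (1 - q ^ (7 * n + (7 - k))) * (1 - q ^ (7 * n + 7)))
    = (\<Prod>n. (1 - q ^ k * (q ^ 7) ^ n) * (1 - q ^ (7 - k) * (q ^ 7) ^ n) * (1 - q ^ 7 * (q ^ 7) ^ n))"
    by simp
  also have "\<dots> = theta7 k q * qpoch (q ^ 7) (q ^ 7)"
    unfolding theta7_def qpoch_def
    by (simp only: prodinf_mult convergent_prod_mult convergent_qpoch[OF p])
  finally show ?thesis .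
qed

text \<open>168 is the least common multiple of 56 and 24, so every fractional power of
  \<open>q\<close> in play is an integer power of the single root \<open>t\<close>.\<close>

lemma product_forms:
  fixes \<tau> :: complex
  assumes "\<tau> \<in> uhp"
  defines "t \<equiv> qpow (1 / 168) \<tau>" and "q \<equiv> qq \<tau>"
  defines "P \<equiv> qpoch (q ^ 7) (q ^ 7)"
  shows "u7 \<tau> = t ^ 3 * (theta7 3 q * P)" "v7 \<tau> = t ^ 27 * (theta7 2 q * P)" "w7 \<tau> = t ^ 75 * (theta7 1 q * P)"
    and "eta \<tau> = t ^ 7 * (theta7 1 q * theta7 2 q * theta7 3 q * P)" "eta (7 * \<tau>) = t ^ 49 * P"
    and "q = t ^ 168" "qpow (1 / 3) \<tau> = t ^ 56"
proof -
  have q: "norm q < 1"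
    unfolding q_def using assms(1) by (rule norm_qq_less_1)
  have t: "qpow (of_nat n / 168) \<tau> = t ^ n" for n
    using qpow_of_nat_mult[of n "1 / 168" \<tau>] by (simp add: t_def)
  have "qq (7 * \<tau>) = q ^ 7"
    using qpow_of_nat_mult[of 7 1 \<tau>] by (simp add: q_def qq_def) (simp add: qpow_def mult_ac)
  moreover have "qpow (1 / 24) (7 * \<tau>) = qpow (49 / 168) \<tau>"
    by (simp add: qpow_def mult_ac)
  ultimately show "eta (7 * \<tau>) = t ^ 49 * P"
    using t[of 49] by (simp add: eta_def P_def qpoch_def)
  show "eta \<tau> = t ^ 7 * (theta7 1 q * theta7 2 q * theta7 3 q * P)"
    using t[of 7] qpoch_eq_theta7[OF q] by (simp add: eta_def P_def qpoch_def q_def)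
  show "u7 \<tau> = t ^ 3 * (theta7 3 q * P)" "v7 \<tau> = t ^ 27 * (theta7 2 q * P)" "w7 \<tau> = t ^ 75 * (theta7 1 q * P)"
    using t[of 3] t[of 27] t[of 75] prodinf_theta7[OF q, of 3] prodinf_theta7[OF q, of 2] prodinf_theta7[OF q, of 1]
    by (simp_all add: u7_def v7_def w7_def P_def q_def)
  show "q = t ^ 168" "qpow (1 / 3) \<tau> = t ^ 56"
    using t[of 168] t[of 56] by (simp_all add: q_def qq_def)
qed

theorem theorem8:
  shows "\<exists>c :: complex \<Rightarrow> complex.
     c holomorphic_on uhp \<and>
     (\<forall>\<tau>\<in>uhp. c \<tau> ^ 3 = j7star \<tau>) \<and>
     (\<exists>M. eventually (\<lambda>\<tau>. norm (qpow (1/3) \<tau> * c \<tau> - 1) \<le> M * norm (qq \<tau>)) at_i_infinity) \<and>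
     (\<forall>\<tau>\<in>uhp.
        u7 \<tau> ^ 4 / v7 \<tau> ^ 2 + w7 \<tau> ^ 4 / u7 \<tau> ^ 2 + v7 \<tau> ^ 4 / w7 \<tau> ^ 2
          = 2 * eta \<tau> ^ 2 * c \<tau> \<and>
        v7 \<tau> ^ 2 / u7 \<tau> ^ 4 + u7 \<tau> ^ 2 / w7 \<tau> ^ 4 + w7 \<tau> ^ 2 / v7 \<tau> ^ 4
          = eta \<tau> ^ 2 / eta (7*\<tau>) ^ 4 * (c \<tau>) ^ 2)"
proof (intro exI conjI ballI)
  \<comment> \<open>\<open>qpow\<close> fixes the branch of q^(1/3), so the quotient is single
    valued.\<close>
  let ?c = "\<lambda>\<tau>. cube_root_factor (qq \<tau>) / qpow (1/3) \<tau>"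
  show "?c holomorphic_on uhp"
  proof -
    have "qq holomorphic_on uhp"
      unfolding qq_def[abs_def] by (intro holomorphic_intros)
    hence "cube_root_factor \<circ> qq holomorphic_on uhp"
      by (rule holomorphic_on_compose_gen[OF _ cube_root_factor_holomorphic]) (auto simp: norm_qq_less_1)
    thus ?thesis
      unfolding comp_def by (intro holomorphic_intros) auto
  qed
  \<comment> \<open>The difference quotient at \<open>0\<close> tends to the derivative; adding 1
    leaves room for an eventual bound.\<close>
  show "eventually (\<lambda>\<tau>. norm (qpow (1/3) \<tau> * ?c \<tau> - 1)
      \<le> (norm (deriv cube_root_factor 0) + 1) * norm (qq \<tau>)) at_i_infinity"
  proof -
    have "cube_root_factor field_differentiable at 0"
      using holomorphic_on_imp_differentiable_at[OF cube_root_factor_holomorphic] by simp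
    hence "((\<lambda>z. (cube_root_factor z - 1) / z) \<longlongrightarrow> deriv cube_root_factor 0) (at 0)"
      by (simp add: DERIV_deriv_iff_field_differentiable[symmetric] has_field_derivative_iff)
    hence "eventually (\<lambda>z. norm ((cube_root_factor z - 1) / z) < norm (deriv cube_root_factor 0) + 1) (at 0)"
      by (intro order_tendstoD(2)[OF tendsto_norm]) auto
    \<comment> \<open>\<open>qq\<close> never vanishes, so it approaches \<open>0\<close> through
      punctured neighbourhoods.\<close>
    moreover have "filterlim qq (at 0) at_i_infinity"
      using qq_tendsto_0 by (simp add: filterlim_at)
    ultimately have "eventually (\<lambda>\<tau>. norm ((cube_root_factor (qq \<tau>) - 1) / qq \<tau>)
        < norm (deriv cube_root_factor 0) + 1) at_i_infinity"
      by (rule eventually_compose_filterlim)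
    thus ?thesis
      by eventually_elim (simp add: norm_divide divide_simps)
  qed
  fix \<tau> assume \<tau>: "\<tau> \<in> uhp"
  define t q where "t = qpow (1/168) \<tau>" "q = qq \<tau>"
  define a b c P where "a = theta7 1 q" "b = theta7 2 q" "c = theta7 3 q"
    "P = qpoch (q ^ 7) (q ^ 7)"
  define K where "K = cube_root_factor q"
  have q: "q \<noteq> 0" "norm q < 1"
    using \<tau> by (simp_all add: t_q_def norm_qq_less_1)
  have nz: "a \<noteq> 0" "b \<noteq> 0" "c \<noteq> 0" "P \<noteq> 0" "t \<noteq> 0"
    using q by (simp_all add: a_b_c_P_def t_q_def theta7_nonzero qpoch_nonzero norm_power_less_1)
  note forms = product_forms[OF \<tau>, folded t_q_def, folded a_b_c_P_def]
  have cK: "?c \<tau> = K / t ^ 56"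
    by (simp add: K_def t_q_def forms)
  note K = cube_root_factor_identities[OF q, folded a_b_c_P_def, folded K_def]
  have K_def': "K = (c ^ 4 / b\<^sup>2 + q\<^sup>2 * a ^ 4 / c\<^sup>2 + b ^ 4 / a\<^sup>2) / (2 * (a * b * c)\<^sup>2)"
    by (simp add: K_def cube_root_factor_def a_b_c_P_def)
  \<comment> \<open>\<open>T\<close> is q^(1/4), the power of \<open>q\<close> in
    \<open>eta \<tau> / eta (7 * \<tau>) = M / T\<close>.\<close>
  define M T W where "M = a * b * c" "T = t ^ 42" "W = P\<^sup>2"
  have M: "M \<noteq> 0" "T \<noteq> 0" "W \<noteq> 0"
    using nz by (simp_all add: M_T_W_def)
  \<comment> \<open>These reductions give all terms of the first sum the common factor
    \<open>W / T\<close>, and those of the second \<open>T / (q\<^sup>2 * W)\<close>.\<close>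
  have t_powers: "t ^ 49 = t ^ 7 * T" "t ^ 54 = t ^ 12 * T" "t ^ 150 = t ^ 108 * T" "t ^ 56 = t ^ 14 * T"
      "t ^ 300 = t ^ 6 * (q\<^sup>2 / T)" "t ^ 14 / (t ^ 196 * t ^ 112) = T / q\<^sup>2" "T ^ 4 = q" "(t ^ 56) ^ 3 = q"
    unfolding M_T_W_def forms(6) using nz
    by (simp_all add: nonzero_eq_divide_eq nonzero_divide_eq_eq divide_eq_eq eq_divide_eq
        flip: power_add power_mult)
  have P4: "P ^ 4 = W * W" "P\<^sup>2 = W"
    by (simp_all add: M_T_W_def flip: power_add)
  have "eta \<tau> / eta (7 * \<tau>) = M / T"
    using nz by (simp add: forms t_powers M_T_W_def(1))
  moreover from this have "eta (7 * \<tau>) / eta \<tau> = T / M"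
    by (metis inverse_divide)
  ultimately have j: "j7star \<tau> = M ^ 4 / q + 13 + 49 * (q / M ^ 4)"
    by (simp add: j7star_def power_divide t_powers)
  have "?c \<tau> ^ 3 = (M ^ 4 + 13 * q + 49 * q\<^sup>2 / M ^ 4) / q"
    by (simp only: cK power_divide K(1) t_powers(8) M_T_W_def(1))
  also have "\<dots> = j7star \<tau>"
    unfolding j using q by (simp add: add_divide_distrib power2_eq_square)
  finally show "?c \<tau> ^ 3 = j7star \<tau>" .
  have "u7 \<tau> ^ 4 / v7 \<tau> ^ 2 = c ^ 4 / b\<^sup>2 * (W / T)"
      "w7 \<tau> ^ 4 / u7 \<tau> ^ 2 = q\<^sup>2 * a ^ 4 / c\<^sup>2 * (W / T)"
      "v7 \<tau> ^ 4 / w7 \<tau> ^ 2 = b ^ 4 / a\<^sup>2 * (W / T)"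
    using nz M by (simp_all add: forms(1-3) power_mult_distrib t_powers P4 mult_ac flip: power_mult)
  hence "u7 \<tau> ^ 4 / v7 \<tau> ^ 2 + w7 \<tau> ^ 4 / u7 \<tau> ^ 2 + v7 \<tau> ^ 4 / w7 \<tau> ^ 2
      = (c ^ 4 / b\<^sup>2 + q\<^sup>2 * a ^ 4 / c\<^sup>2 + b ^ 4 / a\<^sup>2) * (W / T)"
    by (simp only: distrib_right)
  also have "\<dots> = 2 * M\<^sup>2 * K * (W / T)"
    using M by (simp add: K_def' M_T_W_def(1)[symmetric])
  also have "\<dots> = 2 * eta \<tau> ^ 2 * ?c \<tau>"
    unfolding cK forms(4) M_T_W_def(1)[symmetric] using nz
    by (simp add: t_powers power_mult_distrib P4 mult_ac flip: power_mult)
  finally show "u7 \<tau> ^ 4 / v7 \<tau> ^ 2 + w7 \<tau> ^ 4 / u7 \<tau> ^ 2 + v7 \<tau> ^ 4 / w7 \<tau> ^ 2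
      = 2 * eta \<tau> ^ 2 * ?c \<tau>" .
  have "v7 \<tau> ^ 2 / u7 \<tau> ^ 4 = q\<^sup>2 * (b\<^sup>2 / c ^ 4) * (T / (q\<^sup>2 * W))"
      "u7 \<tau> ^ 2 / w7 \<tau> ^ 4 = c\<^sup>2 / a ^ 4 * (T / (q\<^sup>2 * W))"
      "w7 \<tau> ^ 2 / v7 \<tau> ^ 4 = q\<^sup>2 * (a\<^sup>2 / b ^ 4) * (T / (q\<^sup>2 * W))"
    using nz M q by (simp_all add: forms(1-3) power_mult_distrib t_powers P4 mult_ac flip: power_mult)
  hence "v7 \<tau> ^ 2 / u7 \<tau> ^ 4 + u7 \<tau> ^ 2 / w7 \<tau> ^ 4 + w7 \<tau> ^ 2 / v7 \<tau> ^ 4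
      = (q\<^sup>2 * (b\<^sup>2 / c ^ 4) + c\<^sup>2 / a ^ 4 + q\<^sup>2 * (a\<^sup>2 / b ^ 4)) * (T / (q\<^sup>2 * W))"
    by (simp only: distrib_right)
  \<comment> \<open>\<open>T / q\<^sup>2\<close> is written as the powers of \<open>t\<close> in
    \<open>eta \<tau> ^ 2\<close>, \<open>eta (7*\<tau>) ^ 4\<close> and the square of
    \<open>?c \<tau>\<close>.\<close>
  also have "\<dots> = M\<^sup>2 * K\<^sup>2 / W * (t ^ 14 / (t ^ 196 * t ^ 112))"
    unfolding K(2) t_powers M_T_W_def(1)[symmetric] by simp
  also have "\<dots> = eta \<tau> ^ 2 / eta (7*\<tau>) ^ 4 * (?c \<tau>) ^ 2"
    unfolding cK forms(4,5) M_T_W_def(1)[symmetric] using nz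
    by (simp add: power_mult_distrib power_divide P4 mult_ac flip: power_mult)
  finally show "v7 \<tau> ^ 2 / u7 \<tau> ^ 4 + u7 \<tau> ^ 2 / w7 \<tau> ^ 4 + w7 \<tau> ^ 2 / v7 \<tau> ^ 4
      = eta \<tau> ^ 2 / eta (7*\<tau>) ^ 4 * (?c \<tau>) ^ 2" .
qed

end
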